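(* Let $\mathcal{G}(p)$ be an infinitesimally bearing rigid framework in $\mathbb{R}^d$ with $n\ge 2$ vertices, $d\ge 2$. Then $\mathcal{G}(p)$ is uniquely determined by its inter-neighbor bearings up to a translation and a scaling factor; that is, for every framework $\mathcal{G}(p')$ in $\mathbb{R}^d$ that is bearing equivalent to $\mathcal{G}(p)$ there exist $c\in\mathbb{R}\setminus\{0\}$ and $\eta\in\mathbb{R}^d$ such that $p'=cp+\mathbf{1}\otimes\eta$.
   Context: Let $\mathcal{G}=(\mathcal{V},\mathcal{E})$ be an undirected graph without self-loops, $\mathcal{V}=\{1,\dots,n\}$, with $m$ edges. A configuration is $p=[p_1^{\mathrm T},\dots,p_n^{\mathrm T}]^{\mathrm T}\in\mathbb{R}^{dn}$ with $p_i\in\mathbb{R}^d$; a framework $\mathcal{G}(p)$ in $\mathbb{R}^d$ is the graph together with a configuration such that $p_i\ne p_j$ for all $(i,j)\in\mathcal{E}$. $\mathbf{1}=[1,\dots,1]^{\mathrm T}\in\mathbb{R}^n$. For nonzero $x\in\mathbb{R}^d$, $P_x=I_d-\frac{xx^{\mathrm T}}{\|x\|^2}$. Frameworks $\mathcal{G}(p)$ and $\mathcal{G}(p')$ (same graph) are bearing equivalent if $P_{(p_i-p_j)}(p_i'-p_j')=0$ for all $(i,j)\in\mathcal{E}$. Fix an arbitrary orientation of $\mathcal{G}$. For the $k$th directed edge, from $i$ to $j$, let $e_k=p_j-p_i$ and $g_k=e_k/\|e_k\|$ (the bearing). The bearing rigidity matrix is the Jacobian $R(p)=\partial F_B(p)/\partial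 p\in\mathbb{R}^{dm\times dn}$ of the bearing function $F_B(p)=[g_1^{\mathrm T},\dots,g_m^{\mathrm T}]^{\mathrm T}$. A vector $\delta p\in\mathbb{R}^{dn}$ with $R(p)\delta p=0$ is an infinitesimal bearing motion; it is trivial if it corresponds to a translation and a scaling of the entire framework, i.e. $\delta p=\mathbf{1}\otimes x+\alpha p$ for some $x\in\mathbb{R}^d$, $\alpha\in\mathbb{R}$. The framework $\mathcal{G}(p)$ is infinitesimally bearing rigid if all its infinitesimal bearing motions are trivial. *)

theory Defs
  imports "HOL-Analysis.Analysis"
begin

text \<open>
  The vertices are the elements of a finite type \<open>'n\<close>, and \<open>\<real>\<^sup>d\<close> is \<open>real^'d\<close>.
  A configuration is the stacked vector in \<open>\<real>\<^bsup>dn\<^esup>\<close>, of type \<open>real^('n \<times> 'd)\<close>; its entry \<open>(i, a)\<close>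
  is the \<open>a\<close>-th coordinate of the point \<open>p\<^sub>i\<close>.
\<close>

definition point :: "real^('n::finite \<times> 'd::finite) \<Rightarrow> 'n \<Rightarrow> real^'d" where
  "point p i = (\<chi> a. p $ (i, a))"

definition kron :: "real^'n::finite \<Rightarrow> real^'d::finite \<Rightarrow> real^('n \<times> 'd)" where
  "kron u x = (\<chi> ia. u $ fst ia * x $ snd ia)"

text \<open>Both ordered pairs \<open>(i, j)\<close> and \<open>(j, i)\<close> of an undirected edge belong to the edge set.\<close>

definition undirected_graph :: "('n \<times> 'n) set \<Rightarrow> bool" where
  "undirected_graph E \<longleftrightarrow> sym E \<and> irrefl E"

definition framework :: "('n::finite \<times> 'n) set \<Rightarrow> real^('n \<times> 'd::finite) \<Rightarrow> bool" where
  "framework E p \<longleftrightarrow> (\<forall>(i, j) \<in> E. point p i \<noteq> point p j)"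

definition orth_proj :: "real^'d::finite \<Rightarrow> real^'d^'d" where
  "orth_proj x =
     mat 1 - (1 / (norm x)\<^sup>2) *\<^sub>R ((columnvector x :: real^1^'d) ** (rowvector x :: real^'d^1))"

definition bearing_equivalent ::
    "('n::finite \<times> 'n) set \<Rightarrow> real^('n \<times> 'd::finite) \<Rightarrow> real^('n \<times> 'd) \<Rightarrow> bool" where
  "bearing_equivalent E p p' \<longleftrightarrow>
     (\<forall>(i, j) \<in> E. orth_proj (point p i - point p j) *v (point p' i - point p' j) = 0)"

text \<open>
  An orientation enumerates the undirected edges, each exactly once and in exactly one direction,
  so its length is the number \<open>m\<close> of edges; the edges are numbered \<open>0, \<dots>, m - 1\<close>.
\<close>

definition orientation :: "('n \<times> 'n) set \<Rightarrow> ('n \<times> 'n) list \<Rightarrow> bool" where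
  "orientation E es \<longleftrightarrow>
     distinct es \<and> set es \<inter> (set es)\<inverse> = {} \<and> set es \<union> (set es)\<inverse> = E"

definition edge_vector :: "('n::finite \<times> 'n) list \<Rightarrow> real^('n \<times> 'd::finite) \<Rightarrow> nat \<Rightarrow> real^'d" where
  "edge_vector es p k = point p (snd (es ! k)) - point p (fst (es ! k))"

text \<open>The bearing function is given by its blocks \<open>g\<^sub>k \<in> \<real>\<^sup>d\<close>, for \<open>k < m\<close>.\<close>

definition bearing_function :: "('n::finite \<times> 'n) list \<Rightarrow> real^('n \<times> 'd::finite) \<Rightarrow> nat \<Rightarrow> real^'d" where
  "bearing_function es p k = edge_vector es p k /\<^sub>R norm (edge_vector es p k)"

text \<open>
  The Jacobian of the bearing function is given by its block rows for \<open>k < m\<close>, each a \<open>d \<times> dn\<close>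
  matrix. A vector is in the kernel of the whole \<open>dm \<times> dn\<close> matrix iff every block row
  annihilates it. Indexing the blocks by numbers rather than by a type allows \<open>m = 0\<close>.
\<close>

definition bearing_rigidity_matrix ::
    "('n::finite \<times> 'n) list \<Rightarrow> real^('n \<times> 'd::finite) \<Rightarrow> nat \<Rightarrow> real^('n \<times> 'd)^'d" where
  "bearing_rigidity_matrix es p k = jacobian (\<lambda>q. bearing_function es q k) (at p)"

definition infinitesimal_bearing_motion ::
    "('n::finite \<times> 'n) list \<Rightarrow> real^('n \<times> 'd::finite) \<Rightarrow> real^('n \<times> 'd) \<Rightarrow> bool" where
  "infinitesimal_bearing_motion es p v \<longleftrightarrow>
     (\<forall>k < length es. bearing_rigidity_matrix es p k *v v = 0)"

definition trivial_motion :: "real^('n::finite \<times> 'd::finite) \<Rightarrow> real^('n \<times> 'd) \<Rightarrow> bool" where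
  "trivial_motion p v \<longleftrightarrow> (\<exists>x \<alpha>. v = kron 1 x + \<alpha> *\<^sub>R p)"

definition infinitesimally_bearing_rigid ::
    "('n::finite \<times> 'n) list \<Rightarrow> real^('n \<times> 'd::finite) \<Rightarrow> bool" where
  "infinitesimally_bearing_rigid es p \<longleftrightarrow>
     (\<forall>v. infinitesimal_bearing_motion es p v \<longrightarrow> trivial_motion p v)"

end

theory Submission
  imports Defs
begin

text \<open>
  Differentiating \<open>e\<^sub>k / \<parallel>e\<^sub>k\<parallel>\<close> shows that the \<open>k\<close>th block of \<open>R(p) v\<close> is the orthogonal
  projection of \<open>v\<^sub>j - v\<^sub>i\<close> onto the complement of \<open>e\<^sub>k\<close>, divided by \<open>\<parallel>e\<^sub>k\<parallel>\<close>. Hence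
  a configuration bearing equivalent to \<open>p\<close> is, read as a vector, an infinitesimal bearing motion of \<open>p\<close>, and rigidity gives \<open>p' = c p + 1 \<otimes> \<eta>\<close>.
  If \<open>c\<close> were zero, all points of \<open>p'\<close> would coincide, which is impossible as soon as the graph has
  an edge; and without edges every vector would be a motion, whereas for \<open>d \<ge> 2\<close> one can displace
  a single vertex in a direction not parallel to a difference vector of \<open>p\<close>.
\<close>

lemma point_add: "point (p + q) i = point p i + point q i"
  by (simp add: point_def vec_eq_iff)

lemma point_scaleR: "point (c *\<^sub>R p) i = c *\<^sub>R point p i"
  by (simp add: point_def vec_eq_iff)

lemma point_kron: "point (kron u x) i = u $ i *\<^sub>R x"
  by (simp add: point_def kron_def vec_eq_iff)

lemma bounded_linear_edge_vector: "bounded_linear (\<lambda>q. edge_vector es q k)"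
  by (intro linear_conv_bounded_linear[THEN iffD1] linearI)
    (simp_all add: edge_vector_def point_add point_scaleR algebra_simps)

lemma orth_proj_mult:
  fixes x y :: "real^'d::finite"
  shows "orth_proj x *v y = y - ((x \<bullet> y) / (norm x)\<^sup>2) *\<^sub>R x"
proof -
  have "((columnvector x :: real^1^'d) ** (rowvector x :: real^'d^1)) *v y = (x \<bullet> y) *\<^sub>R x"
    by (simp add: vec_eq_iff matrix_matrix_mult_def matrix_vector_mult_def columnvector_def
        rowvector_def inner_vec_def sum_distrib_left mult_ac)
  then show ?thesis
    by (simp add: orth_proj_def matrix_vector_mult_diff_rdistrib scaleR_matrix_vector_assoc[symmetric])
qed

text \<open>By the product rule the derivative is h / |x| - (x . h) x / |x|^3; the second term
  removes the component of h along x.\<close>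

lemma has_derivative_normalize:
  fixes x :: "real^'d::finite"
  assumes "x \<noteq> 0"
  shows "((\<lambda>x. x /\<^sub>R norm x) has_derivative (\<lambda>h. (orth_proj x *v h) /\<^sub>R norm x)) (at x)"
  using assms
  by (auto intro!: derivative_eq_intros has_derivative_norm ext
      simp: orth_proj_mult sgn_div_norm divide_simps power2_eq_square inner_commute algebra_simps)

lemma bearing_rigidity_matrix_mult:
  assumes "edge_vector es p k \<noteq> 0"
  shows "bearing_rigidity_matrix es p k *v v =
    (orth_proj (edge_vector es p k) *v edge_vector es v k) /\<^sub>R norm (edge_vector es p k)"
proof -
  have "((\<lambda>q. bearing_function es q k) has_derivative
      (\<lambda>v. (orth_proj (edge_vector es p k) *v edge_vector es v k) /\<^sub>R norm (edge_vector es p k))) (at p)"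
    (is "(_ has_derivative ?D) _")
    unfolding bearing_function_def
    by (rule has_derivative_compose[OF bounded_linear_imp_has_derivative[OF bounded_linear_edge_vector]
          has_derivative_normalize[OF assms]])
  \<comment> \<open>Linearity of \<open>?D\<close> makes the matrix of the derivative act on
    \<open>v\<close> as \<open>?D\<close> itself.\<close>
  then have "frechet_derivative (\<lambda>q. bearing_function es q k) (at p) = ?D" "linear ?D"
    using frechet_derivative_at has_derivative_linear by (metis, blast)
  then show ?thesis
    by (simp add: bearing_rigidity_matrix_def jacobian_def)
qed

lemma bearing_equivalent_imp_infinitesimal_bearing_motion:
  assumes "orientation E es" "framework E p" "bearing_equivalent E p p'"
  shows "infinitesimal_bearing_motion es p p'"
  unfolding infinitesimal_bearing_motion_def
proof (intro allI impI)
  fix k assume "k < length es"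
  \<comment> \<open>\<open>edge_vector\<close> is head minus tail, so the reversed pair yields
    exactly the differences in \<open>bearing_equivalent\<close>.\<close>
  then have "(snd (es ! k), fst (es ! k)) \<in> E"
    using assms(1) nth_mem[of k es] by (auto simp: orientation_def)
  then have "edge_vector es p k \<noteq> 0" "orth_proj (edge_vector es p k) *v edge_vector es p' k = 0"
    using assms(2,3) by (auto simp: framework_def bearing_equivalent_def edge_vector_def)
  then show "bearing_rigidity_matrix es p k *v p' = 0"
    by (simp add: bearing_rigidity_matrix_mult)
qed

lemma exists_nontrivial_motion:
  fixes p :: "real^('n::finite \<times> 'd::finite)"
  assumes "CARD('n) \<ge> 2" "CARD('d) \<ge> 2"
  shows "\<exists>v. \<not> trivial_motion p v"
proof -
  obtain i j :: 'n where ij: "i \<noteq> j"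
    using assms(1) card_le_Suc0_iff_eq[of "UNIV :: 'n set"] by fastforce
  \<comment> \<open>One vector spans dimension at most 1 < d, so some \<open>y\<close> lies
    outside.\<close>
  have "dim (span {point p i - point p j}) < DIM(real^'d)"
    using dim_le_card[of "{point p i - point p j}" "{point p i - point p j}"] assms(2)
    by (simp add: span_base)
  then obtain y where y: "y \<notin> span {point p i - point p j}"
    by (metis UNIV_eq_I dim_UNIV less_irrefl)
  \<comment> \<open>Only vertex \<open>i\<close> moves, by \<open>y\<close>. If this were trivial,
    the zero displacement at \<open>j\<close> would determine \<open>x\<close>, leaving
    \<open>y\<close> a multiple of \<open>point p i - point p j\<close>.\<close>
  have "\<not> trivial_motion p (kron (axis i 1) y)"
  proof
    assume "trivial_motion p (kron (axis i 1) y)"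
    then obtain x \<alpha> where eq: "kron (axis i 1) y = kron 1 x + \<alpha> *\<^sub>R p"
      by (auto simp: trivial_motion_def)
    have "point (kron (axis i 1) y) i = x + \<alpha> *\<^sub>R point p i"
         "point (kron (axis i 1) y) j = x + \<alpha> *\<^sub>R point p j"
      by (simp_all add: eq point_add point_scaleR point_kron)
    then have "y = x + \<alpha> *\<^sub>R point p i" "0 = x + \<alpha> *\<^sub>R point p j"
      using ij by (simp_all add: point_kron axis_def)
    then have "y = \<alpha> *\<^sub>R (point p i - point p j)"
      by (simp add: algebra_simps)
    with y show False
      by (simp add: span_mul span_base)
  qed
  then show ?thesis by blast
qed

theorem theorem6:
  fixes E :: "('n::finite \<times> 'n) set"
    and es :: "('n \<times> 'n) list"
    and p :: "real^('n \<times> 'd::finite)"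
  assumes "CARD('n) \<ge> 2"
    and "CARD('d) \<ge> 2"
    and "undirected_graph E"
    and "orientation E es"
    and "framework E p"
    and "infinitesimally_bearing_rigid es p"
  shows "\<forall>p' :: real^('n \<times> 'd). framework E p' \<and> bearing_equivalent E p p' \<longrightarrow>
           (\<exists>c \<eta>. c \<noteq> 0 \<and> p' = c *\<^sub>R p + kron 1 \<eta>)"
proof (intro allI impI)
  fix p' :: "real^('n \<times> 'd)"
  assume p': "framework E p' \<and> bearing_equivalent E p p'"
  then have "trivial_motion p p'"
    using assms(4-6) bearing_equivalent_imp_infinitesimal_bearing_motion
    unfolding infinitesimally_bearing_rigid_def by blast
  then obtain c \<eta> where eq: "p' = kron 1 \<eta> + c *\<^sub>R p"
    by (auto simp: trivial_motion_def)
  \<comment> \<open>For empty \<open>es\<close> the kernel condition is vacuous, so rigidity would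
    make every vector trivial.\<close>
  have "es \<noteq> []"
    using exists_nontrivial_motion[OF assms(1,2), of p] assms(6)
    by (auto simp: infinitesimally_bearing_rigid_def infinitesimal_bearing_motion_def)
  then obtain i j where "(i, j) \<in> E"
    using assms(4) by (cases es) (auto simp: orientation_def)
  then have "point p' i \<noteq> point p' j"
    using p' by (auto simp: framework_def)
  then have "c \<noteq> 0"
    by (auto simp: eq point_add point_scaleR point_kron)
  then show "\<exists>c \<eta>. c \<noteq> 0 \<and> p' = c *\<^sub>R p + kron 1 \<eta>"
    using eq by (auto simp: add.commute)
qed

end
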